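(* Let $X,Y$ be compact metric spaces, $\omega$ a Radon measure on $X$, and let $\mathcal F\subset C^+(X)$ and $\mathcal T:\mathcal F\to C_s(X,Y)$ be such that $\mathcal F$ is $\mathcal T$-concave and property (A3) (defined in the context) holds, with functions $h_{t,y}$, $y\in Y$, $\alpha_y<t<\beta_y$. Let $\{\mu_l\}_{l\ge1}$ be a sequence of discrete Radon measures on $Y$, $\mu_l=\sum_{i=1}^{N_l}g_i^{l}\,\delta_{p_i^{l}}$ with $N_l\ge 2$, $p_1^l,\dots,p_{N_l}^l$ distinct points of $Y$ and $g_i^l>0$, such that $\mu_l\to\mu$ weakly, where $\mu$ is a Radon measure on $Y$, and $\mu_l(Y)=\omega(X)$ for $l\ge 1$. For each $l$ let $\rho_l$ be a function of the form $$\rho_l(x)=\min_{1\le i\le N_l}h_{b_i^l,p_i^l}(x),\qquad b_i^l\in(\alpha_{p_i^l},\beta_{p_i^l}),$$ with $M_{\mathcal T(\rho_l)}=\mu_l$. Assume that there exists $R_0>0$ such that $R_0\in\mathrm{Range}(\rho_l)$ for all $l\ge 1$. Suppose that (i) for each $R_1>0$ there exists $C_{R_1}>0$ such that $C_{R_1}^{-1}\le h_{t,y}\le C_{R_1}$ on $X$ whenever $y\in Y$, $t\in(\alpha_y,\beta_y)$ and $R_1\in\mathrm{Range}(h_{t,y})$; (ii) for any $C_1>C_0>0$, the family $\{f\in\mathcal F: C_0\le f\le C_1\text{ in }X\}$ is compact in $C(X)$. Then there exists $\rho\in\mathcal F$ satisfying $M_{\mathcal T(\rho)}=\mu$.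
   Context: Let $X,Y$ be compact metric spaces and $\omega$ a Radon measure on $X$ (nonnegative, finite, completed). A set-valued map $\Phi$ from $X$ to $Y$ assigns to each $x\in X$ a nonempty subset $\Phi(x)\subset Y$. $Y^X$ denotes the class of set-valued maps $\Phi$ from $X$ to $Y$ such that $\Phi(x)$ is a singleton for $\omega$-a.e. $x$. A map $\Phi\in Y^X$ is continuous at $x_0\in X$ if, whenever $x_k\to x_0$ and $y_k\in\Phi(x_k)$, there are a subsequence $y_{k_j}$ and $y_0\in\Phi(x_0)$ with $y_{k_j}\to y_0$. $C(X,Y)$ is the class of $\Phi\in Y^X$ continuous at every point of $X$, and $C_s(X,Y)$ is the class of $\Phi\in C(X,Y)$ with $\Phi(X)=\bigcup_{x\in X}\Phi(x)=Y$. For $\Phi\in C_s(X,Y)$ and $E\subset Y$, $\Phi^{-1}(E)=\{x\in X:\Phi(x)\cap E\ne\emptyset\}$, and $M_\Phi(E)=\omega(\Phi^{-1}(E))$, which is a Radon measure on $Y$. $C(X)$ is the set of real continuous functions on $X$ with the topology of uniform convergence; $C^+(X)$ is the set of continuous positive functions on $X$. A map $\mathcal T:\mathcal F\to C_s(X,Y)$, $\mathcal F\subset C(X)$, is continuous at $\phi\in\mathcal F$ if whenever $\phi_j\in\mathcal F$, $\phi_j\to\phi$ uniformly in $X$, $x_0\in X$ and $y_j\in\mathcal T(\phi_j)(x_0)$, there is a subsequence $y_{j_\ell}$ converging to some $y_0\in\mathcal T(\phi)(x_0)$. A class $\mathcal F\subset C^+(X)$ is $\mathcal T$-concave if: (A1)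 $f_1,f_2\in\mathcal F$ implies $f_1\wedge f_2=\min\{f_1,f_2\}\in\mathcal F$; and $\mathcal T:\mathcal F\to C_s(X,Y)$ is a map that is continuous at each $\phi\in\mathcal F$ and satisfies (A2): if $\phi_1,\phi_2\in\mathcal F$ and $\phi_1(x_0)\le\phi_2(x_0)$, then $\mathcal T(\phi_1)(x_0)\subset\mathcal T(\phi_1\wedge\phi_2)(x_0)$. Property (A3): for each $y_0\in Y$ there exist an interval $(\alpha_{y_0},\beta_{y_0})$ (endpoints possibly infinite) and a family $\{h_{t,y_0}\}_{\alpha_{y_0}<t<\beta_{y_0}}\subset\mathcal F$ such that (a) $y_0\in\mathcal T(h_{t,y_0})(x)$ for all $x\in X$; (b) $h_{t,y_0}\le h_{s,y_0}$ for $t\le s$; (c) $h_{t,y_0}\to 0$ uniformly as $t\to\alpha_{y_0}$; (d) $\max_{x\in X}|h_{t',y_0}(x)-h_{t,y_0}(x)|\to 0$ as $t'\to t$, for $\alpha_{y_0}<t<\beta_{y_0}$. *)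

theory Defs
  imports "HOL-Probability.Probability"
begin

text \<open>
  A compact metric space is a type of class \<open>metric_space\<close> whose universe is compact; the
  compactness is an assumption of the theorem and is not needed by the definitions.
\<close>

section \<open>Radon measures\<close>

text \<open>
  Finite, inner regular Borel measures, completed: the measurable sets are the Borel sets
  together with all sets that differ from a Borel set by a subset of a Borel null set.
\<close>

definition radon_measure :: "'a::topological_space measure \<Rightarrow> bool" where
  "radon_measure M \<longleftrightarrow>
     (\<exists>B. sets B = sets borel \<and> finite_measure B \<and>
          (\<forall>A\<in>sets borel. emeasure B A = (SUP K\<in>{K. compact K \<and> K \<subseteq> A}. emeasure B K)) \<and>
          M = completion B)"

definition weakly_converges :: "(nat \<Rightarrow> 'a::topological_space measure) \<Rightarrow> 'a measure \<Rightarrow> bool" where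
  "weakly_converges \<mu>s \<mu> \<longleftrightarrow>
     (\<forall>f :: 'a \<Rightarrow>\<^sub>C real. (\<lambda>l. integral\<^sup>L (\<mu>s l) (apply_bcontfun f))
                           \<longlonglongrightarrow> integral\<^sup>L \<mu> (apply_bcontfun f))"

section \<open>Set-valued maps\<close>

definition set_valued_maps :: "'a measure \<Rightarrow> ('a \<Rightarrow> 'b set) set" where
  "set_valued_maps \<omega> = {\<Phi>. (\<forall>x. \<Phi> x \<noteq> {}) \<and> (AE x in \<omega>. is_singleton (\<Phi> x))}"

definition sv_continuous_at :: "('a::metric_space \<Rightarrow> 'b::metric_space set) \<Rightarrow> 'a \<Rightarrow> bool" where
  "sv_continuous_at \<Phi> x0 \<longleftrightarrow>
     (\<forall>x y. x \<longlonglongrightarrow> x0 \<longrightarrow> (\<forall>k. y k \<in> \<Phi> (x k)) \<longrightarrow>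
        (\<exists>r y0. strict_mono r \<and> y0 \<in> \<Phi> x0 \<and> (y \<circ> r) \<longlonglongrightarrow> y0))"

definition C_maps :: "'a::metric_space measure \<Rightarrow> ('a \<Rightarrow> 'b::metric_space set) set" where
  "C_maps \<omega> = {\<Phi> \<in> set_valued_maps \<omega>. \<forall>x. sv_continuous_at \<Phi> x}"

definition Cs_maps :: "'a::metric_space measure \<Rightarrow> ('a \<Rightarrow> 'b::metric_space set) set" where
  "Cs_maps \<omega> = {\<Phi> \<in> C_maps \<omega>. (\<Union>x. \<Phi> x) = UNIV}"

definition sv_preimage :: "('a \<Rightarrow> 'b set) \<Rightarrow> 'b set \<Rightarrow> 'a set" where
  "sv_preimage \<Phi> E = {x. \<Phi> x \<inter> E \<noteq> {}}"

text \<open>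
  The measure \<open>E \<mapsto> \<omega>(\<Phi>\<^sup>-\<^sup>1(E))\<close> as a completed Borel measure.  For continuous \<open>\<Phi>\<close>
  and Radon \<open>\<omega>\<close>, the lemmas \<open>sv_preimage_measurable\<close> and \<open>emeasure_sv_measure\<close> below show
  that it is well defined, so that no default value of \<open>measure_of\<close> or \<open>emeasure\<close> is involved.
\<close>

definition sv_measure :: "'a measure \<Rightarrow> ('a \<Rightarrow> 'b::topological_space set) \<Rightarrow> 'b measure" where
  "sv_measure \<omega> \<Phi> =
     completion (measure_of UNIV (sets borel) (\<lambda>E. emeasure \<omega> (sv_preimage \<Phi> E)))"

lemma radon_measureE:
  assumes "radon_measure M"
  obtains B where "sets B = sets borel" "M = completion B"
  using assms unfolding radon_measure_def by blast

lemma radon_measure_complete: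
  assumes "radon_measure M" shows "complete_measure M"
proof -
  obtain B where "M = completion B" using assms by (rule radon_measureE)
  then show ?thesis by (simp add: completion.complete_measure_axioms)
qed

lemma sets_radon_measure:
  assumes "radon_measure M" shows "sets borel \<subseteq> sets M"
proof -
  obtain B where B: "sets B = sets borel" "M = completion B" using assms by (rule radon_measureE)
  show ?thesis unfolding B(2) B(1)[symmetric] by (rule subsetI) (rule sets_completionI_sets)
qed

lemma space_radon_measure:
  assumes "radon_measure M" shows "space M = UNIV"
proof -
  obtain B where B: "sets B = sets borel" "M = completion B" using assms by (rule radon_measureE)
  show ?thesis using sets_eq_imp_space_eq[OF B(1)] B(2) by simp
qed

lemma closed_sv_preimage:
  assumes "\<And>x. sv_continuous_at \<Phi> x" "closed E"
  shows "closed (sv_preimage \<Phi> E)"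
  unfolding closed_sequential_limits
proof (intro allI impI)
  fix x l assume *: "(\<forall>n. x n \<in> sv_preimage \<Phi> E) \<and> x \<longlonglongrightarrow> l"
  then have "\<forall>n. \<exists>y. y \<in> \<Phi> (x n) \<and> y \<in> E" by (auto simp: sv_preimage_def)
  then obtain y where y: "\<And>n. y n \<in> \<Phi> (x n)" "\<And>n. y n \<in> E" by metis
  obtain r y0 where r: "strict_mono (r :: nat \<Rightarrow> nat)" "y0 \<in> \<Phi> l" "(y \<circ> r) \<longlonglongrightarrow> y0"
    using assms(1)[of l] * y(1) unfolding sv_continuous_at_def by blast
  have "y0 \<in> E"
    using closed_sequentially[OF assms(2) _ r(3)] y(2) by simp
  with r(2) show "l \<in> sv_preimage \<Phi> E" by (auto simp: sv_preimage_def)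
qed

lemma not_singleton_null:
  assumes "radon_measure \<omega>" "\<Phi> \<in> C_maps \<omega>"
  shows "{x. \<not> is_singleton (\<Phi> x)} \<in> null_sets \<omega>"
proof -
  interpret complete_measure \<omega> by (rule radon_measure_complete[OF assms(1)])
  show ?thesis
    using assms(2) AE_iff_null_sets[of "\<lambda>x. is_singleton (\<Phi> x)"]
    by (simp add: C_maps_def set_valued_maps_def space_radon_measure[OF assms(1)])
qed

lemma sv_preimage_measurable:
  assumes R: "radon_measure \<omega>" and Phi: "\<Phi> \<in> C_maps \<omega>" and E: "E \<in> sets borel"
  shows "sv_preimage \<Phi> E \<in> sets \<omega>"
proof -
  interpret complete_measure \<omega> by (rule radon_measure_complete[OF R])
  define N where "N = {x. \<not> is_singleton (\<Phi> x)}"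
  have N: "N \<in> null_sets \<omega>" unfolding N_def by (rule not_singleton_null[OF R Phi])
  have cont: "sv_continuous_at \<Phi> x" and ne: "\<Phi> x \<noteq> {}" for x
    using Phi unfolding C_maps_def set_valued_maps_def by blast+
  have "E \<in> sigma_sets UNIV (Collect closed)"
    using E unfolding borel_eq_closed by simp
  then show ?thesis
  proof induction
    case (Basic a)
    then have "closed (sv_preimage \<Phi> a)"
      by (intro closed_sv_preimage cont) simp
    then show ?case
      by (intro subsetD[OF sets_radon_measure[OF R]] borel_closed)
  next
    case Empty
    then show ?case by (simp add: sv_preimage_def)
  next
    case (Compl a)
    have eq: "sv_preimage \<Phi> (UNIV - a) = (UNIV - sv_preimage \<Phi> a) \<union> (N \<inter> sv_preimage \<Phi> (UNIV - a))"
    proof (intro set_eqI iffI)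
      fix x assume x: "x \<in> sv_preimage \<Phi> (UNIV - a)"
      show "x \<in> (UNIV - sv_preimage \<Phi> a) \<union> (N \<inter> sv_preimage \<Phi> (UNIV - a))"
      proof (cases "x \<in> N")
        case False
        then obtain z where "\<Phi> x = {z}" by (auto simp: N_def is_singleton_def)
        then show ?thesis using x by (auto simp: sv_preimage_def)
      qed (use x in simp)
    next
      fix x assume "x \<in> (UNIV - sv_preimage \<Phi> a) \<union> (N \<inter> sv_preimage \<Phi> (UNIV - a))"
      then show "x \<in> sv_preimage \<Phi> (UNIV - a)" using ne[of x] by (auto simp: sv_preimage_def)
    qed
    have "N \<inter> sv_preimage \<Phi> (UNIV - a) \<in> sets \<omega>"
      by (rule null_setsD2[OF complete2[OF Int_lower1 N]])
    moreover have "UNIV - sv_preimage \<Phi> a \<in> sets \<omega>"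
      using sets.compl_sets[OF Compl.IH] by (simp add: space_radon_measure[OF R])
    ultimately show ?case
      by (subst eq) (rule sets.Un)
  next
    case (Union a)
    have "sv_preimage \<Phi> (\<Union>i. a i) = (\<Union>i. sv_preimage \<Phi> (a i))"
      by (auto simp: sv_preimage_def)
    then show ?case using Union.IH by auto
  qed
qed

lemma emeasure_sv_measure:
  assumes R: "radon_measure \<omega>" and Phi: "\<Phi> \<in> C_maps \<omega>" and E: "E \<in> sets borel"
  shows "emeasure (sv_measure \<omega> \<Phi>) E = emeasure \<omega> (sv_preimage \<Phi> E)"
proof -
  define N where "N = {x. \<not> is_singleton (\<Phi> x)}"
  have N: "N \<in> null_sets \<omega>" unfolding N_def by (rule not_singleton_null[OF R Phi])
  let ?m = "\<lambda>E. emeasure \<omega> (sv_preimage \<Phi> E)"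
  let ?M = "measure_of UNIV (sets borel) ?m"
  note meas = sv_preimage_measurable[OF R Phi]
  have "emeasure ?M E = ?m E"
  proof (rule emeasure_measure_of_sigma)
    show "sigma_algebra UNIV (sets (borel :: 'b measure))"
      using sets.sigma_algebra_axioms[of "borel :: 'b measure"] by simp
    show "positive (sets borel) ?m" by (simp add: positive_def sv_preimage_def)
    show "countably_additive (sets borel) ?m"
      unfolding countably_additive_def
    proof (intro allI impI)
      fix A :: "nat \<Rightarrow> 'b set"
      assume A: "range A \<subseteq> sets borel" and d: "disjoint_family A"
      have m: "sv_preimage \<Phi> (A i) \<in> sets \<omega>" for i using A meas by blast
      have dis: "disjoint_family (\<lambda>i. sv_preimage \<Phi> (A i) - N)"
        unfolding disjoint_family_on_def
      proof (intro ballI impI equals0I)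
        fix i j x assume "i \<noteq> j"
          and x: "x \<in> (sv_preimage \<Phi> (A i) - N) \<inter> (sv_preimage \<Phi> (A j) - N)"
        then have "A i \<inter> A j = {}" using d by (auto simp: disjoint_family_on_def)
        moreover obtain z where "\<Phi> x = {z}" using x by (auto simp: N_def is_singleton_def)
        ultimately show False using x by (auto simp: sv_preimage_def)
      qed
      have "(\<Sum>i. ?m (A i)) = (\<Sum>i. emeasure \<omega> (sv_preimage \<Phi> (A i) - N))"
        using N m by (simp add: emeasure_Diff_null_set)
      also have "\<dots> = emeasure \<omega> (\<Union>i. sv_preimage \<Phi> (A i) - N)"
        using dis m N by (intro suminf_emeasure) auto
      also have "(\<Union>i. sv_preimage \<Phi> (A i) - N) = sv_preimage \<Phi> (\<Union>i. A i) - N"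
        by (auto simp: sv_preimage_def)
      also have "emeasure \<omega> \<dots> = ?m (\<Union>i. A i)"
        using N A by (intro emeasure_Diff_null_set meas) auto
      finally show "(\<Sum>i. ?m (A i)) = ?m (\<Union>i. A i)" .
    qed
  qed (rule E)
  moreover have "E \<in> sets ?M"
    using E sets.sigma_sets_eq[of "borel :: 'b measure"] by (simp add: sets_measure_of_conv)
  ultimately show ?thesis by (simp add: sv_measure_def)
qed

section \<open>The map \<open>\<T>\<close> and its properties\<close>

text \<open>
  The class \<open>\<F>\<close> is a set of real functions, and \<open>\<T>\<close> is a total function of which only the
  values on \<open>\<F>\<close> are constrained.
\<close>

definition C_plus :: "('a::topological_space \<Rightarrow> real) set" where
  "C_plus = {f. continuous_on UNIV f \<and> (\<forall>x. 0 < f x)}"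

definition T_continuous_at ::
  "('a \<Rightarrow> real) set \<Rightarrow> (('a \<Rightarrow> real) \<Rightarrow> 'a \<Rightarrow> 'b::metric_space set) \<Rightarrow> ('a \<Rightarrow> real) \<Rightarrow> bool" where
  "T_continuous_at \<F> \<T> \<phi> \<longleftrightarrow>
     (\<forall>\<phi>s x0 y. (\<forall>j. \<phi>s j \<in> \<F>) \<longrightarrow> uniform_limit UNIV \<phi>s \<phi> sequentially \<longrightarrow>
        (\<forall>j. y j \<in> \<T> (\<phi>s j) x0) \<longrightarrow>
        (\<exists>r y0. strict_mono r \<and> y0 \<in> \<T> \<phi> x0 \<and> (y \<circ> r) \<longlonglongrightarrow> y0))"

definition T_concave ::
  "'a::metric_space measure \<Rightarrow> ('a \<Rightarrow> real) set
     \<Rightarrow> (('a \<Rightarrow> real) \<Rightarrow> 'a \<Rightarrow> 'b::metric_space set) \<Rightarrow> bool" where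
  "T_concave \<omega> \<F> \<T> \<longleftrightarrow>
     \<F> \<subseteq> C_plus \<and>
     (\<forall>f1\<in>\<F>. \<forall>f2\<in>\<F>. (\<lambda>x. min (f1 x) (f2 x)) \<in> \<F>) \<and>
     (\<forall>\<phi>\<in>\<F>. \<T> \<phi> \<in> Cs_maps \<omega>) \<and>
     (\<forall>\<phi>\<in>\<F>. T_continuous_at \<F> \<T> \<phi>) \<and>
     (\<forall>\<phi>1\<in>\<F>. \<forall>\<phi>2\<in>\<F>. \<forall>x0. \<phi>1 x0 \<le> \<phi>2 x0 \<longrightarrow>
        \<T> \<phi>1 x0 \<subseteq> \<T> (\<lambda>x. min (\<phi>1 x) (\<phi>2 x)) x0)"

text \<open>
  Property (A3) for given endpoints \<open>\<alpha> y\<close>, \<open>\<beta> y\<close> and functions \<open>h t y\<close>; only parameters \<open>t\<close>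
  in the open interval are constrained.  The filter in the limit \<open>t \<rightarrow> \<alpha> y\<close> is
  \<open>at_right a\<close> if \<open>\<alpha> y = ereal a\<close> and \<open>at_bot\<close> if \<open>\<alpha> y = -\<infinity>\<close>.
\<close>

definition property_A3 ::
  "('a \<Rightarrow> real) set \<Rightarrow> (('a \<Rightarrow> real) \<Rightarrow> 'a \<Rightarrow> 'b set)
     \<Rightarrow> ('b \<Rightarrow> ereal) \<Rightarrow> ('b \<Rightarrow> ereal) \<Rightarrow> (real \<Rightarrow> 'b \<Rightarrow> 'a \<Rightarrow> real) \<Rightarrow> bool" where
  "property_A3 \<F> \<T> \<alpha> \<beta> h \<longleftrightarrow>
     (\<forall>y. \<alpha> y < \<beta> y \<and>
        (\<forall>t. \<alpha> y < ereal t \<and> ereal t < \<beta> y \<longrightarrow> h t y \<in> \<F>) \<and>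
        (\<forall>t. \<alpha> y < ereal t \<and> ereal t < \<beta> y \<longrightarrow> (\<forall>x. y \<in> \<T> (h t y) x)) \<and>
        (\<forall>t s. \<alpha> y < ereal t \<and> t \<le> s \<and> ereal s < \<beta> y \<longrightarrow> (\<forall>x. h t y x \<le> h s y x)) \<and>
        uniform_limit UNIV (\<lambda>t. h t y) (\<lambda>x. 0) (filtercomap ereal (at_right (\<alpha> y))) \<and>
        (\<forall>t. \<alpha> y < ereal t \<and> ereal t < \<beta> y \<longrightarrow>
           ((\<lambda>t'. SUP x. \<bar>h t' y x - h t y x\<bar>) \<longlongrightarrow> 0) (at t)))"

end

theory Submission
  imports Defs
begin

text \<open>
  The solution is a uniform limit of the discrete solutions \<open>\<rho>\<^sub>l\<close>, so two things are at stake: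
  compactness of the sequence, and continuity of \<open>\<rho> \<mapsto> M\<^bsub>\<T>(\<rho>)\<^esub>\<close> from uniform to weak convergence.

  Compactness needs a two-sided bound on the \<open>\<rho>\<^sub>l\<close> that does not depend on \<open>l\<close>.  If \<open>\<rho>\<^sub>l\<close> takes the
  value \<open>R\<^sub>0\<close> at \<open>x\<^sub>0\<close>, then the member \<open>h\<^bsub>b,p\<^esub>\<close> of the minimum that is active at \<open>x\<^sub>0\<close> takes
  this value as well.  The Harnack-type hypothesis, which bounds every \<open>h\<^bsub>t,y\<^esub>\<close> that takes a
  given value \<open>R\<^sub>1\<close> from both sides in terms of \<open>R\<^sub>1\<close> alone, bounds it, hence \<open>\<rho>\<^sub>l\<close>, from above.
  Every other member is at least \<open>R\<^sub>0\<close> at \<open>x\<^sub>0\<close>.  It need not take the value \<open>R\<^sub>0\<close> anywhere, but its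
  parameter can be lowered until it does: along the family \<open>t \<mapsto> h\<^bsub>t,p\<^esub>(x\<^sub>0)\<close> the values vary
  continuously and tend to zero.  The Harnack-type hypothesis bounds the lowered function from
  below, and by monotonicity in \<open>t\<close> also the original one (\<open>A3_lower_bound\<close>).  Compactness of the functions of \<open>\<F>\<close> between two positive constants then yields a subsequence converging
  uniformly to some \<open>\<rho> \<in> \<F>\<close>.

  For the passage to the limit, \<open>M\<^bsub>\<Phi>\<^esub>\<close> is realised as the push-forward of \<open>\<omega>\<close> under a selection
  of \<open>\<Phi>\<close> (\<open>sv_measure_eq_distr\<close>), since \<open>\<Phi>\<close> is almost everywhere single-valued.  Continuity of
  \<open>\<T>\<close> says that the selections converge at every point where the limit map is single-valued, and
  dominated convergence gives weak convergence of the push-forwards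
  (\<open>integral_selection_tendsto\<close>).  Finally, a finite Borel measure on a metric space is
  determined by its integrals of bounded continuous functions, so the weak limit \<open>\<mu>\<close> coincides
  with \<open>M\<^bsub>\<T>(\<rho>)\<^esub>\<close>.
\<close>

section \<open>Bounded continuous functions determine a finite Borel measure\<close>

text \<open>
  The functions \<open>max 0 (1 - n * dist(x, E))\<close> are bounded, continuous, and decrease to the indicator
  function of a closed set \<open>E\<close>.
\<close>

lemma measure_closed_eq_lim_bcontfun:
  fixes M :: "'b::metric_space measure"
  assumes sets: "sets M = sets borel" and fin: "finite_measure M"
    and E: "closed E" "E \<noteq> {}"
  shows "(\<lambda>n. \<integral>x. max 0 (1 - real n * infdist x E) \<partial>M) \<longlonglongrightarrow> measure M E"
proof -
  interpret finite_measure M by (rule fin)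
  have E_sets: "E \<in> sets M" using E sets by auto
  have "(\<lambda>n. \<integral>x. max 0 (1 - real n * infdist x E) \<partial>M) \<longlonglongrightarrow> (\<integral>x. indicator E x \<partial>M)"
  proof (rule integral_dominated_convergence[where w = "\<lambda>_. 1"])
    show "(\<lambda>x. max 0 (1 - real n * infdist x E)) \<in> borel_measurable M" for n
      unfolding measurable_cong_sets[OF sets refl]
      by (intro borel_measurable_continuous_onI continuous_intros)
    show "AE x in M. (\<lambda>n. max 0 (1 - real n * infdist x E)) \<longlonglongrightarrow> indicator E x"
    proof (rule AE_I2)
      fix x
      show "(\<lambda>n. max 0 (1 - real n * infdist x E)) \<longlonglongrightarrow> indicator E x"
      proof (cases "x \<in> E")
        case False
        then have pos: "infdist x E > 0"
          using in_closed_iff_infdist_zero[OF E, of x] infdist_nonneg[of x E] by linarith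
        obtain m where m: "1 / infdist x E < real m" using reals_Archimedean2 by blast
        have "max 0 (1 - real n * infdist x E) = 0" if "n \<ge> m" for n
        proof -
          have "1 / infdist x E < real n" using m that by linarith
          then show ?thesis using pos by (simp add: field_simps)
        qed
        then show ?thesis using False
          by (intro tendsto_eventually) (auto simp: eventually_sequentially)
      qed simp
    qed
    show "AE x in M. norm (max 0 (1 - real n * infdist x E)) \<le> 1" for n
      by (simp add: infdist_nonneg)
  qed (use E_sets in auto)
  then show ?thesis using E_sets sets_eq_imp_space_eq[OF sets] by simp
qed

lemma finite_measure_eqI_bcontfun:
  fixes M N :: "'b::metric_space measure"
  assumes M: "sets M = sets borel" "finite_measure M"
    and N: "sets N = sets borel" "finite_measure N"
    and eq: "\<And>f :: 'b \<Rightarrow>\<^sub>C real. integral\<^sup>L M (apply_bcontfun f) = integral\<^sup>L N (apply_bcontfun f)"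
  shows "M = N"
proof -
  interpret M: finite_measure M by (rule M(2))
  interpret N: finite_measure N by (rule N(2))
  have closed: "emeasure M E = emeasure N E" if E: "closed E" for E
  proof (cases "E = {}")
    case False
    have "(\<integral>x. max 0 (1 - real n * infdist x E) \<partial>M) = (\<integral>x. max 0 (1 - real n * infdist x E) \<partial>N)"
      for n
    proof -
      have bc: "(\<lambda>x. max 0 (1 - real n * infdist x E)) \<in> bcontfun"
        by (rule bcontfun_normI[where b = 1])
          (auto intro!: continuous_intros simp: infdist_nonneg)
      from eq[of "Bcontfun (\<lambda>x. max 0 (1 - real n * infdist x E))"] show ?thesis
        by (simp add: Bcontfun_inverse[OF bc])
    qed
    then have "measure M E = measure N E"
      using measure_closed_eq_lim_bcontfun[OF M E False]
        measure_closed_eq_lim_bcontfun[OF N E False]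
      by (auto intro: LIMSEQ_unique)
    then show ?thesis by (simp add: M.emeasure_eq_measure N.emeasure_eq_measure)
  qed simp
  show ?thesis
  proof (rule measure_eqI_generator_eq[where E = "Collect closed" and \<Omega> = UNIV and A = "\<lambda>_. UNIV"])
    show "Int_stable (Collect (closed :: 'b set \<Rightarrow> bool))" by (auto simp: Int_stable_def)
    show "sets M = sigma_sets UNIV (Collect closed)" "sets N = sigma_sets UNIV (Collect closed)"
      by (simp_all add: M N borel_eq_closed)
  qed (use closed in auto)
qed

section \<open>Selections and push-forward measures\<close>

definition selection :: "('a \<Rightarrow> 'b set) \<Rightarrow> 'a \<Rightarrow> 'b" where
  "selection \<Phi> x = (SOME y. y \<in> \<Phi> x)"

lemma selection_in: "\<Phi> \<in> C_maps \<omega> \<Longrightarrow> selection \<Phi> x \<in> \<Phi> x"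
  unfolding selection_def C_maps_def set_valued_maps_def by (auto intro: some_in_eq[THEN iffD2])

lemma C_maps_AE_singleton:
  "\<Phi> \<in> C_maps \<omega> \<Longrightarrow> AE x in \<omega>. is_singleton (\<Phi> x)"
  by (simp add: C_maps_def set_valued_maps_def)

text \<open>
  Where \<open>\<Phi> x\<close> is a singleton, its only element is the selected one, so that hitting \<open>E\<close> and being
  mapped into \<open>E\<close> by the selection agree off a null set.
\<close>

lemma AE_selection_vimage:
  assumes "\<Phi> \<in> C_maps \<omega>"
  shows "AE x in \<omega>. x \<in> sv_preimage \<Phi> E \<longleftrightarrow> x \<in> selection \<Phi> -` E"
  using C_maps_AE_singleton[OF assms]
proof eventually_elim
  case (elim x)
  then obtain z where "\<Phi> x = {z}" by (auto simp: is_singleton_def)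
  moreover from this selection_in[OF assms, of x] have "selection \<Phi> x = z" by simp
  ultimately show ?case by (simp add: sv_preimage_def)
qed

lemma selection_measurable:
  assumes "radon_measure \<omega>" "\<Phi> \<in> C_maps \<omega>"
  shows "selection \<Phi> \<in> measurable \<omega> borel"
proof (rule measurableI)
  interpret complete_measure \<omega> by (rule radon_measure_complete[OF assms(1)])
  fix E :: "'b set" assume "E \<in> sets borel"
  then show "selection \<Phi> -` E \<inter> space \<omega> \<in> sets \<omega>"
    using in_sets_AE[OF AE_selection_vimage[OF assms(2)] sv_preimage_measurable[OF assms], of E]
    by (simp add: space_radon_measure[OF assms(1)])
qed simp

lemma sv_measure_eq_distr:
  assumes "radon_measure \<omega>" "\<Phi> \<in> C_maps \<omega>"
  shows "sv_measure \<omega> \<Phi> = completion (distr \<omega> borel (selection \<Phi>))"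
proof -
  have "measure_of UNIV (sets borel) (\<lambda>E. emeasure \<omega> (sv_preimage \<Phi> E)) =
    measure_of UNIV (sets borel) (\<lambda>E. emeasure \<omega> (selection \<Phi> -` E \<inter> space \<omega>))"
  proof (rule measure_of_eq)
    fix E :: "'b set" assume "E \<in> sigma_sets UNIV (sets borel)"
    then have E: "E \<in> sets borel" using sets.sigma_sets_eq[of "borel :: 'b measure"] by simp
    show "emeasure \<omega> (sv_preimage \<Phi> E) = emeasure \<omega> (selection \<Phi> -` E \<inter> space \<omega>)"
      using AE_selection_vimage[OF assms(2), of E] sv_preimage_measurable[OF assms E]
        measurable_sets[OF selection_measurable[OF assms] E]
      by (intro emeasure_eq_AE) (auto simp: space_radon_measure[OF assms(1)])
  qed simp
  then show ?thesis by (simp add: sv_measure_def distr_def)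
qed

lemma finite_radon_measure:
  assumes "radon_measure M"
  shows "finite_measure M"
proof -
  obtain B where B: "finite_measure B" "M = completion B"
    using assms unfolding radon_measure_def by blast
  interpret finite_measure B by (rule B(1))
  show ?thesis by (rule finite_measureI) (simp add: B(2))
qed

lemma integral_sv_measure:
  fixes f :: "'b::metric_space \<Rightarrow> real"
  assumes "radon_measure \<omega>" "\<Phi> \<in> C_maps \<omega>" "f \<in> borel_measurable borel"
  shows "integral\<^sup>L (sv_measure \<omega> \<Phi>) f = (\<integral>x. f (selection \<Phi> x) \<partial>\<omega>)"
  using assms by (simp add: sv_measure_eq_distr integral_completion integral_distr
      selection_measurable)

section \<open>Continuity of the measure in the potential\<close>

text \<open>
  The definition of continuity of \<open>\<T>\<close> provides convergent subsequences only; a single possible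
  limit upgrades this to convergence of the whole sequence.
\<close>

lemma T_continuous_at_tendsto:
  assumes cont: "T_continuous_at \<F> \<T> \<phi>" and in_F: "\<And>j. \<phi>s j \<in> \<F>"
    and lim: "uniform_limit UNIV \<phi>s \<phi> sequentially"
    and single: "\<T> \<phi> x = {y0}" and y: "\<And>j. y j \<in> \<T> (\<phi>s j) x"
  shows "y \<longlonglongrightarrow> y0"
proof (rule topological_tendstoI, rule ccontr)
  fix S assume S: "open S" "y0 \<in> S" and "\<not> (\<forall>\<^sub>F j in sequentially. y j \<in> S)"
  then have "infinite {j. y j \<notin> S}"
    by (simp add: not_eventually cofinite_eq_sequentially[symmetric] frequently_cofinite)
  then obtain r :: "nat \<Rightarrow> nat" where r: "strict_mono r" "\<And>j. y (r j) \<notin> S"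
    using infinite_enumerate by (metis mem_Collect_eq)
  have "uniform_limit UNIV (\<lambda>j. \<phi>s (r j)) \<phi> sequentially"
    using filterlim_compose[OF lim filterlim_subseq[OF r(1)]] .
  then obtain s z where s: "strict_mono (s :: nat \<Rightarrow> nat)" "z \<in> \<T> \<phi> x" "((\<lambda>j. y (r j)) \<circ> s) \<longlonglongrightarrow> z"
    using cont[unfolded T_continuous_at_def, rule_format, of "\<lambda>j. \<phi>s (r j)" "\<lambda>j. y (r j)" x]
      in_F y by blast
  then have "\<forall>\<^sub>F j in sequentially. y (r (s j)) \<in> S"
    using topological_tendstoD[OF s(3) S(1)] S(2) single by simp
  with r(2) show False by simp
qed

lemma integral_selection_tendsto:
  fixes f :: "'b::metric_space \<Rightarrow>\<^sub>C real" and \<omega> :: "'a::metric_space measure"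
  assumes \<omega>: "radon_measure \<omega>" and T: "T_concave \<omega> \<F> \<T>"
    and in_F: "\<And>j. \<phi>s j \<in> \<F>" "\<phi> \<in> \<F>"
    and lim: "uniform_limit UNIV \<phi>s \<phi> sequentially"
  shows "(\<lambda>j. \<integral>x. f (selection (\<T> (\<phi>s j)) x) \<partial>\<omega>) \<longlonglongrightarrow> (\<integral>x. f (selection (\<T> \<phi>) x) \<partial>\<omega>)"
proof -
  interpret finite_measure \<omega> by (rule finite_radon_measure[OF \<omega>])
  have C: "\<T> \<psi> \<in> C_maps \<omega>" if "\<psi> \<in> \<F>" for \<psi>
    using T that by (auto simp: T_concave_def Cs_maps_def)
  have cont: "continuous_on UNIV (apply_bcontfun f)" by simp
  have meas: "(\<lambda>x. f (selection (\<T> \<psi>) x)) \<in> borel_measurable \<omega>" if "\<psi> \<in> \<F>" for \<psi>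
    using measurable_compose[OF selection_measurable[OF \<omega> C[OF that]]
        borel_measurable_continuous_onI[OF cont]] .
  show ?thesis
  proof (rule integral_dominated_convergence[where w = "\<lambda>_. norm f"])
    show "AE x in \<omega>. (\<lambda>j. f (selection (\<T> (\<phi>s j)) x)) \<longlonglongrightarrow> f (selection (\<T> \<phi>) x)"
      using C_maps_AE_singleton[OF C[OF in_F(2)]]
    proof eventually_elim
      case (elim x)
      then obtain z where z: "\<T> \<phi> x = {z}" by (auto simp: is_singleton_def)
      have sel: "selection (\<T> \<phi>) x = z" using selection_in[OF C[OF in_F(2)], of x] z by simp
      have "(\<lambda>j. selection (\<T> (\<phi>s j)) x) \<longlonglongrightarrow> z"
      proof (rule T_continuous_at_tendsto[where \<phi>s = \<phi>s and \<T> = \<T>, OF _ in_F(1) lim z])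
        show "T_continuous_at \<F> \<T> \<phi>" using T in_F(2) by (simp add: T_concave_def)
      qed (rule selection_in[OF C[OF in_F(1)]])
      then show ?case unfolding sel
        by (rule continuous_on_tendsto_compose[OF cont]) auto
    qed
    show "AE x in \<omega>. norm (f (selection (\<T> (\<phi>s j)) x)) \<le> norm f" for j
      by (simp add: norm_bounded del: real_norm_def)
  qed (simp_all add: meas in_F)
qed

section \<open>Bounds for the potentials\<close>

lemma T_concave_Min:
  assumes T: "T_concave \<omega> \<F> \<T>" and I: "finite I" "I \<noteq> {}" and in_F: "\<And>i. i \<in> I \<Longrightarrow> f i \<in> \<F>"
  shows "(\<lambda>x. MIN i\<in>I. f i x) \<in> \<F>"
  using I in_F
proof (induction I rule: finite_ne_induct)
  case (insert i I)
  have "(\<lambda>x. min (f i x) (MIN i\<in>I. f i x)) \<in> \<F>"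
    using T insert by (simp add: T_concave_def)
  then show ?case using insert.hyps by simp
qed simp

text \<open>
  A supremum of an unbounded set of reals is a meaningless default value, so
  the bound by the supremum needs compactness of the space and continuity of the two functions.
\<close>

lemma A3_continuous_parameter:
  fixes h :: "real \<Rightarrow> 'b \<Rightarrow> 'a::metric_space \<Rightarrow> real"
  assumes X: "compact (UNIV :: 'a set)" and F: "\<F> \<subseteq> C_plus" and A3: "property_A3 \<F> \<T> \<alpha> \<beta> h"
    and t: "\<alpha> y < ereal t" "ereal t < \<beta> y"
  shows "isCont (\<lambda>t. h t y x) t"
proof -
  have in_F: "h s y \<in> \<F>" if "\<alpha> y < ereal s" "ereal s < \<beta> y" for s
    using A3 that by (simp add: property_A3_def)
  have sup: "((\<lambda>s. SUP x. \<bar>h s y x - h t y x\<bar>) \<longlongrightarrow> 0) (at t)"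
    using A3 t by (simp add: property_A3_def)
  have near: "\<forall>\<^sub>F s in at t. \<alpha> y < ereal s \<and> ereal s < \<beta> y"
  proof -
    have "((\<lambda>s. ereal s) \<longlongrightarrow> ereal t) (at t)" by (intro tendsto_intros)
    from order_tendstoD[OF this] t show ?thesis by (intro eventually_conj) auto
  qed
  have "\<forall>\<^sub>F s in at t. norm (h s y x - h t y x) \<le> (SUP x. \<bar>h s y x - h t y x\<bar>)"
    using near
  proof eventually_elim
    case (elim s)
    have "continuous_on UNIV (\<lambda>x. \<bar>h s y x - h t y x\<bar>)"
      using F in_F[OF t] in_F elim by (intro continuous_intros) (auto simp: C_plus_def)
    then have "bdd_above (range (\<lambda>x. \<bar>h s y x - h t y x\<bar>))"
      by (intro bounded_imp_bdd_above compact_imp_bounded compact_continuous_image X)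
    from cSUP_upper[OF UNIV_I this] show ?case by simp
  qed
  then have "((\<lambda>s. h s y x - h t y x) \<longlongrightarrow> 0) (at t)"
    using sup by (rule Lim_null_comparison)
  then show ?thesis unfolding isCont_def by (simp add: LIM_zero_iff)
qed

lemma A3_small_parameter:
  fixes h :: "real \<Rightarrow> 'b \<Rightarrow> 'a \<Rightarrow> real"
  assumes A3: "property_A3 \<F> \<T> \<alpha> \<beta> h" and s: "\<alpha> y < ereal s" and e: "e > 0"
  obtains t where "\<alpha> y < ereal t" "t < s" "h t y x < e"
proof -
  have "\<forall>\<^sub>F t in filtercomap ereal (at_right (\<alpha> y)). \<forall>x\<in>UNIV. dist (h t y x) 0 < e"
    using A3 e unfolding property_A3_def by (blast dest: uniform_limitD)
  then obtain Q where Q: "\<forall>\<^sub>F u in at_right (\<alpha> y). Q u" "\<And>t x. Q (ereal t) \<Longrightarrow> \<bar>h t y x\<bar> < e"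
    unfolding eventually_filtercomap by (auto simp: dist_real_def)
  obtain c where c: "\<alpha> y < c" "\<And>u. \<alpha> y < u \<Longrightarrow> u < c \<Longrightarrow> Q u"
    using Q(1) eventually_at_right[OF s] by blast
  obtain t where t: "\<alpha> y < ereal t" "ereal t < min c (ereal s)"
    using ereal_dense2[of "\<alpha> y" "min c (ereal s)"] c(1) s by auto
  show ?thesis
    using that[of t] t c(2)[of "ereal t"] Q(2)[of t x] by auto
qed

text \<open>
  The parameter \<open>s\<close> is lowered until the value at \<open>x0\<close> is exactly \<open>R\<close>; this is where
  the one-sided information \<open>h s y x0 \<ge> R\<close> is turned into the hypothesis \<open>R \<in> range (h t y)\<close>
  of the Harnack-type bound.
\<close>

lemma A3_lower_bound:
  fixes h :: "real \<Rightarrow> 'b \<Rightarrow> 'a::metric_space \<Rightarrow> real"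
  assumes X: "compact (UNIV :: 'a set)" and F: "\<F> \<subseteq> C_plus" and A3: "property_A3 \<F> \<T> \<alpha> \<beta> h"
    and s: "\<alpha> y < ereal s" "ereal s < \<beta> y" and R: "0 < R" "R \<le> h s y x0"
    and harnack: "\<And>t x. \<alpha> y < ereal t \<Longrightarrow> ereal t < \<beta> y \<Longrightarrow> R \<in> range (h t y) \<Longrightarrow> c \<le> h t y x"
  shows "c \<le> h s y x"
proof -
  obtain u where u: "\<alpha> y < ereal u" "u < s" "h u y x0 < R"
    using A3_small_parameter[OF A3 s(1) R(1)] by blast
  have between: "\<alpha> y < ereal t \<and> ereal t < \<beta> y" if "u \<le> t" "t \<le> s" for t
    using that u(1) s(2) by (meson ereal_less_eq(3) order.strict_trans1 order.strict_trans2)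
  have "\<exists>t\<ge>u. t \<le> s \<and> h t y x0 = R"
  proof (rule IVT)
    show "\<forall>t. u \<le> t \<and> t \<le> s \<longrightarrow> isCont (\<lambda>t. h t y x0) t"
      using A3_continuous_parameter[OF X F A3] between by blast
  qed (use u R in auto)
  then obtain t where t: "u \<le> t" "t \<le> s" "h t y x0 = R" by blast
  have "c \<le> h t y x" using between[OF t(1,2)] t(3) by (intro harnack) auto
  also have "\<dots> \<le> h s y x"
    using A3 between[OF t(1,2)] s t(2) by (simp add: property_A3_def)
  finally show ?thesis .
qed

text \<open>
  With \<open>R\<close> in the range of the minimum, the active function at the corresponding point gives the
  upper bound, while all functions are at least \<open>R\<close> there, which is what the lower bound starts from.
\<close>

lemma A3_Min_bounds:
  fixes h :: "real \<Rightarrow> 'b \<Rightarrow> 'a::metric_space \<Rightarrow> real"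
  assumes X: "compact (UNIV :: 'a set)" and F: "\<F> \<subseteq> C_plus" and A3: "property_A3 \<F> \<T> \<alpha> \<beta> h"
    and I: "finite I" "I \<noteq> {}"
    and b: "\<And>i. i \<in> I \<Longrightarrow> \<alpha> (p i) < ereal (b i) \<and> ereal (b i) < \<beta> (p i)"
    and R: "R > 0" "R \<in> range (\<lambda>x. MIN i\<in>I. h (b i) (p i) x)"
    and harnack: "\<And>y t x. \<alpha> y < ereal t \<Longrightarrow> ereal t < \<beta> y \<Longrightarrow> R \<in> range (h t y) \<Longrightarrow>
      c \<le> h t y x \<and> h t y x \<le> C"
  shows "c \<le> (MIN i\<in>I. h (b i) (p i) x)" "(MIN i\<in>I. h (b i) (p i) x) \<le> C"
proof -
  obtain x0 where x0: "R = (MIN i\<in>I. h (b i) (p i) x0)" using R(2) by blast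
  have "R \<in> (\<lambda>i. h (b i) (p i) x0) ` I" unfolding x0 using I by (intro Min_in) auto
  then obtain k where k: "k \<in> I" "R = h (b k) (p k) x0" by blast
  have "(MIN i\<in>I. h (b i) (p i) x) \<le> h (b k) (p k) x" using I k(1) by (intro Min_le) auto
  also have "\<dots> \<le> C" using harnack[of "p k" "b k" x] b[OF k(1)] k(2) by blast
  finally show "(MIN i\<in>I. h (b i) (p i) x) \<le> C" .
  have "c \<le> h (b i) (p i) x" if i: "i \<in> I" for i
  proof (rule A3_lower_bound[OF X F A3 _ _ R(1)])
    show "R \<le> h (b i) (p i) x0" unfolding x0 using I i by (intro Min_le) auto
  qed (use b[OF i] harnack in auto)
  then show "c \<le> (MIN i\<in>I. h (b i) (p i) x)" using I by simp
qed

section \<open>Existence of the solution\<close>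

theorem theorem2p8:
  fixes \<omega> :: "'a::metric_space measure"
    and \<F> :: "('a \<Rightarrow> real) set"
    and \<T> :: "('a \<Rightarrow> real) \<Rightarrow> 'a \<Rightarrow> 'b::metric_space set"
    and \<alpha> \<beta> :: "'b \<Rightarrow> ereal"
    and h :: "real \<Rightarrow> 'b \<Rightarrow> 'a \<Rightarrow> real"
    and N :: "nat \<Rightarrow> nat"
    and g b :: "nat \<Rightarrow> nat \<Rightarrow> real"
    and p :: "nat \<Rightarrow> nat \<Rightarrow> 'b"
    and \<mu>s :: "nat \<Rightarrow> 'b measure"
    and \<mu> :: "'b measure"
    and \<rho>s :: "nat \<Rightarrow> 'a \<Rightarrow> real"
    and R0 :: real
  assumes "compact (UNIV :: 'a set)" and "compact (UNIV :: 'b set)"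
    and "radon_measure \<omega>"
    and "T_concave \<omega> \<F> \<T>"
    and "property_A3 \<F> \<T> \<alpha> \<beta> h"
    and "\<And>l. l \<ge> 1 \<Longrightarrow> N l \<ge> 2"
    and "\<And>l. l \<ge> 1 \<Longrightarrow> inj_on (p l) {1..N l}"
    and "\<And>l i. l \<ge> 1 \<Longrightarrow> i \<in> {1..N l} \<Longrightarrow> g l i > 0"
    and "\<And>l. l \<ge> 1 \<Longrightarrow> radon_measure (\<mu>s l)"
    and "\<And>l E. l \<ge> 1 \<Longrightarrow> E \<in> sets borel \<Longrightarrow>
           emeasure (\<mu>s l) E = (\<Sum>i=1..N l. ennreal (g l i) * emeasure (return borel (p l i)) E)"
    and "radon_measure \<mu>"
    and "weakly_converges \<mu>s \<mu>"
    and "\<And>l. l \<ge> 1 \<Longrightarrow> emeasure (\<mu>s l) UNIV = emeasure \<omega> UNIV"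
    and "\<And>l i. l \<ge> 1 \<Longrightarrow> i \<in> {1..N l} \<Longrightarrow>
           \<alpha> (p l i) < ereal (b l i) \<and> ereal (b l i) < \<beta> (p l i)"
    and "\<And>l x. l \<ge> 1 \<Longrightarrow> \<rho>s l x = (MIN i\<in>{1..N l}. h (b l i) (p l i) x)"
    and "\<And>l. l \<ge> 1 \<Longrightarrow> sv_measure \<omega> (\<T> (\<rho>s l)) = \<mu>s l"
    and "R0 > 0" and "\<And>l. l \<ge> 1 \<Longrightarrow> R0 \<in> range (\<rho>s l)"
    and "\<And>R1. R1 > 0 \<Longrightarrow> \<exists>C>0. \<forall>y t. \<alpha> y < ereal t \<and> ereal t < \<beta> y \<and> R1 \<in> range (h t y) \<longrightarrow>
           (\<forall>x. inverse C \<le> h t y x \<and> h t y x \<le> C)"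
    and "\<And>C0 C1. C0 > 0 \<Longrightarrow> C1 > C0 \<Longrightarrow>
           compact {f :: 'a \<Rightarrow>\<^sub>C real. apply_bcontfun f \<in> \<F> \<and>
                      (\<forall>x. C0 \<le> apply_bcontfun f x \<and> apply_bcontfun f x \<le> C1)}"
  shows "\<exists>\<rho>\<in>\<F>. sv_measure \<omega> (\<T> \<rho>) = \<mu>"
proof -
  note X = assms(1) and \<omega> = assms(3) and T = assms(4) and A3 = assms(5) and N = assms(6)
    and \<mu> = assms(11) and weak = assms(12) and b = assms(14) and \<rho>s = assms(15)
    and M = assms(16) and R0 = assms(17,18) and harnack = assms(19) and cpt = assms(20)
  have F: "\<F> \<subseteq> C_plus" using T by (simp add: T_concave_def)
  have C_maps: "\<T> \<phi> \<in> C_maps \<omega>" if "\<phi> \<in> \<F>" for \<phi>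
    using T that by (auto simp: T_concave_def Cs_maps_def)
  obtain C where C: "C > 0"
    "\<And>y t x. \<alpha> y < ereal t \<Longrightarrow> ereal t < \<beta> y \<Longrightarrow> R0 \<in> range (h t y) \<Longrightarrow>
       inverse C \<le> h t y x \<and> h t y x \<le> C"
    using harnack[OF R0(1)] by metis
  have \<rho>_eq: "\<rho>s l = (\<lambda>x. MIN i\<in>{1..N l}. h (b l i) (p l i) x)" if "l \<ge> 1" for l
    using \<rho>s[OF that] by (rule ext)
  have ne: "{1..N l} \<noteq> {}" if "l \<ge> 1" for l using N[OF that] by simp
  have \<rho>_F: "\<rho>s l \<in> \<F>" if l: "l \<ge> 1" for l
    unfolding \<rho>_eq[OF l]
  proof (rule T_concave_Min[OF T _ ne[OF l]])
    show "h (b l i) (p l i) \<in> \<F>" if "i \<in> {1..N l}" for i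
      using A3 b[OF l that] by (simp add: property_A3_def)
  qed simp
  have bounds: "inverse C \<le> \<rho>s l x \<and> \<rho>s l x \<le> C" if l: "l \<ge> 1" for l x
    unfolding \<rho>_eq[OF l]
    using A3_Min_bounds[OF X F A3 _ ne[OF l], of "p l" "b l" R0 "inverse C" C x] C(2) b[OF l]
      R0 l[THEN R0(2), unfolded \<rho>_eq[OF l]]
    by auto
  \<comment> \<open>The compactness hypothesis asks for a nondegenerate interval, hence \<open>C + inverse C\<close> as upper bound.\<close>
  define K where "K = {f :: 'a \<Rightarrow>\<^sub>C real. apply_bcontfun f \<in> \<F> \<and>
    (\<forall>x. inverse C \<le> apply_bcontfun f x \<and> apply_bcontfun f x \<le> C + inverse C)}"
  have K: "compact K" unfolding K_def using C(1) by (intro cpt) auto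
  have bcont: "\<rho>s l \<in> bcontfun" if l: "l \<ge> 1" for l
  proof (rule bcontfun_normI[where b = C])
    show "continuous_on UNIV (\<rho>s l)" using \<rho>_F[OF l] F by (auto simp: C_plus_def)
    show "norm (\<rho>s l x) \<le> C" for x
      using bounds[OF l, of x] positive_imp_inverse_positive[OF C(1)]
      unfolding real_norm_def by linarith
  qed
  define f where "f j = Bcontfun (\<rho>s (Suc j))" for j
  have f: "apply_bcontfun (f j) = \<rho>s (Suc j)" for j
    unfolding f_def by (rule Bcontfun_inverse[OF bcont]) simp
  have "\<forall>j. f j \<in> K"
    using \<rho>_F bounds C(1) by (auto simp: K_def f intro: add_increasing2)
  then obtain F r where lim: "F \<in> K" "strict_mono (r :: nat \<Rightarrow> nat)" "(f \<circ> r) \<longlonglongrightarrow> F"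
    using K unfolding compact_def by metis
  define \<rho> where "\<rho> = apply_bcontfun F"
  have \<rho>: "\<rho> \<in> \<F>" using lim(1) by (simp add: K_def \<rho>_def)
  have unif: "uniform_limit UNIV (\<lambda>j. \<rho>s (Suc (r j))) \<rho> sequentially"
    using tendsto_bcontfun_uniform_limit[OF lim(3)] by (simp add: f \<rho>_def)
  define D where "D = distr \<omega> borel (selection (\<T> \<rho>))"
  interpret finite_measure \<omega> by (rule finite_radon_measure[OF \<omega>])
  have D: "finite_measure D"
    unfolding D_def by (rule finite_measure_distr[OF selection_measurable[OF \<omega> C_maps[OF \<rho>]]])
  obtain B where B: "sets B = sets borel" "finite_measure B" "\<mu> = completion B"
    using \<mu> unfolding radon_measure_def by blast
  have "D = B"
  proof (rule finite_measure_eqI_bcontfun)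
    fix \<phi> :: "'b \<Rightarrow>\<^sub>C real"
    have meas: "apply_bcontfun \<phi> \<in> borel_measurable borel"
      by (intro borel_measurable_continuous_onI) simp
    have subseq: "filterlim (\<lambda>j. Suc (r j)) sequentially sequentially"
      using lim(2) by (intro filterlim_subseq) (simp add: strict_mono_def)
    have int_\<mu>s: "integral\<^sup>L (\<mu>s (Suc (r j))) \<phi> = (\<integral>x. \<phi> (selection (\<T> (\<rho>s (Suc (r j)))) x) \<partial>\<omega>)" for j
      using integral_sv_measure[OF \<omega> C_maps[OF \<rho>_F] meas, of "Suc (r j)"] M[of "Suc (r j)"] by simp
    have int_\<mu>: "integral\<^sup>L \<mu> \<phi> = integral\<^sup>L B \<phi>"
      unfolding B(3)
      by (rule integral_completion) (use meas measurable_cong_sets[OF B(1) refl] in blast)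
    have int_D: "integral\<^sup>L D \<phi> = (\<integral>x. \<phi> (selection (\<T> \<rho>) x) \<partial>\<omega>)"
      unfolding D_def by (rule integral_distr[OF selection_measurable[OF \<omega> C_maps[OF \<rho>]] meas])
    have "(\<lambda>l. integral\<^sup>L (\<mu>s l) \<phi>) \<longlonglongrightarrow> integral\<^sup>L \<mu> \<phi>"
      using weak by (simp add: weakly_converges_def)
    then have "(\<lambda>j. integral\<^sup>L (\<mu>s (Suc (r j))) \<phi>) \<longlonglongrightarrow> integral\<^sup>L B \<phi>"
      using filterlim_compose[OF _ subseq] int_\<mu> by simp
    moreover have "(\<lambda>j. integral\<^sup>L (\<mu>s (Suc (r j))) \<phi>) \<longlonglongrightarrow> integral\<^sup>L D \<phi>"
      unfolding int_\<mu>s int_D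
      by (rule integral_selection_tendsto[OF \<omega> T _ \<rho> unif]) (simp add: \<rho>_F)
    ultimately show "integral\<^sup>L D \<phi> = integral\<^sup>L B \<phi>" by (rule LIMSEQ_unique[symmetric])
  qed (use D B in \<open>auto simp: D_def\<close>)
  then have "sv_measure \<omega> (\<T> \<rho>) = \<mu>"
    using sv_measure_eq_distr[OF \<omega> C_maps[OF \<rho>]] B(3) by (simp add: D_def)
  with \<rho> show ?thesis by blast
qed

end
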